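(* Let $W, A \in \mathbb{R}^{n\times n}$ be symmetric matrices with $A \ge \mathbf{0}$ entrywise and $W_{ij}A_{ij} = 0$ for all $i,j$. Consider the primal problem $$\max\ \{ x^t W x \;:\; x^t A x = 0,\ x \in \{0,1\}^n \}$$ and the dual problem $$\min_{\lambda \ge 0}\ \max_{x \in \{0,1\}^n}\ x^t W x - \lambda\,(x^t A x).$$ Then strong duality holds, in the sense that the optimal values of the two problems are equal and an optimal dual solution corresponds to an optimal primal solution: for every optimal solution $\lambda^* \ge 0$ of the dual problem there exists a maximizer $x^*$ of $x^t W x - \lambda^* (x^t A x)$ over $x \in \{0,1\}^n$ that is an optimal solution of the primal problem.
   Context: The primal problem is called the generalized quadratic stable set problem (GQSS). Since $A \ge \mathbf{0}$, its constraint $x^tAx = 0$ is equivalent on $\{0,1\}^n$ to $x^t A x \le 0$, and the dual problem above is the Lagrangian dual of this inequality-constrained form. *)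

theory Defs
  imports "HOL-Analysis.Analysis"
begin

definition quad_form :: "real ^ 'n ^ 'n \<Rightarrow> real ^ 'n \<Rightarrow> real" where
  "quad_form M x = x \<bullet> (M *v x)"

definition binary_vectors :: "(real ^ 'n) set" where
  "binary_vectors = {x. \<forall>i. x $ i \<in> {0, 1}}"

lemma finite_binary_vectors: "finite (binary_vectors :: (real ^ 'n) set)"
proof -
  have "binary_vectors \<subseteq> vec_lambda ` (UNIV \<rightarrow>\<^sub>E {0, 1} :: ('n \<Rightarrow> real) set)"
  proof
    fix x :: "real ^ 'n"
    assume "x \<in> binary_vectors"
    then have "vec_nth x \<in> UNIV \<rightarrow>\<^sub>E {0, 1}"
      by (auto simp: binary_vectors_def PiE_def)
    moreover have "x = vec_lambda (vec_nth x)"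
      by simp
    ultimately show "x \<in> vec_lambda ` (UNIV \<rightarrow>\<^sub>E {0, 1})"
      by (metis imageI)
  qed
  moreover have "finite (UNIV \<rightarrow>\<^sub>E {0, 1} :: ('n \<Rightarrow> real) set)"
    by (rule finite_PiE) auto
  ultimately show ?thesis
    by (meson finite_imageI finite_subset)
qed

lemma zero_in_binary_vectors: "0 \<in> binary_vectors"
  by (simp add: binary_vectors_def)

definition gqss_feasible :: "real ^ 'n ^ 'n \<Rightarrow> (real ^ 'n) set" where
  "gqss_feasible A = {x \<in> binary_vectors. quad_form A x = 0}"

lemma finite_gqss_feasible: "finite (gqss_feasible A)"
  unfolding gqss_feasible_def by (rule finite_subset[OF _ finite_binary_vectors]) auto

lemma zero_in_gqss_feasible: "0 \<in> gqss_feasible A"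
  by (simp add: gqss_feasible_def zero_in_binary_vectors quad_form_def)

text \<open>The maxima below range over finite nonempty sets, so \<^const>\<open>Max\<close> is meaningful.\<close>

definition gqss_value :: "real ^ 'n ^ 'n \<Rightarrow> real ^ 'n ^ 'n \<Rightarrow> real" where
  "gqss_value W A = Max (quad_form W ` gqss_feasible A)"

definition gqss_optimal :: "real ^ 'n ^ 'n \<Rightarrow> real ^ 'n ^ 'n \<Rightarrow> real ^ 'n \<Rightarrow> bool" where
  "gqss_optimal W A x \<longleftrightarrow> is_arg_max (quad_form W) (\<lambda>y. y \<in> gqss_feasible A) x"

definition lagrangian :: "real ^ 'n ^ 'n \<Rightarrow> real ^ 'n ^ 'n \<Rightarrow> real \<Rightarrow> real ^ 'n \<Rightarrow> real" where
  "lagrangian W A l x = quad_form W x - l * quad_form A x"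

definition lagrangian_maximizer ::
    "real ^ 'n ^ 'n \<Rightarrow> real ^ 'n ^ 'n \<Rightarrow> real \<Rightarrow> real ^ 'n \<Rightarrow> bool" where
  "lagrangian_maximizer W A l x \<longleftrightarrow> is_arg_max (lagrangian W A l) (\<lambda>y. y \<in> binary_vectors) x"

definition dual_function :: "real ^ 'n ^ 'n \<Rightarrow> real ^ 'n ^ 'n \<Rightarrow> real \<Rightarrow> real" where
  "dual_function W A l = Max (lagrangian W A l ` binary_vectors)"

definition dual_optimal :: "real ^ 'n ^ 'n \<Rightarrow> real ^ 'n ^ 'n \<Rightarrow> real \<Rightarrow> bool" where
  "dual_optimal W A l \<longleftrightarrow> is_arg_min (dual_function W A) (\<lambda>m. 0 \<le> m) l"

text \<open>The multipliers form an infinite set, so the dual value is an infimum. It is the minimum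
  precisely when some \<^term>\<open>l\<close> satisfies \<^term>\<open>dual_optimal W A l\<close>.\<close>

definition dual_value :: "real ^ 'n ^ 'n \<Rightarrow> real ^ 'n ^ 'n \<Rightarrow> real" where
  "dual_value W A = (INF l\<in>{0..}. dual_function W A l)"

end

theory Submission
  imports Defs
begin

text \<open>The duality is an exact penalty principle. A feasible point pays no penalty, so its Lagrangian
  value is its primal value for every multiplier; hence the dual function never falls below the
  primal optimum (weak duality, \<open>gqss_value_le_dual_function\<close>). Conversely, since \<open>A\<close> is
  nonnegative, every infeasible binary vector pays a strictly positive penalty, and there are only
  finitely many such vectors, so one large multiplier pushes all of them below the primal optimum
  (\<open>exact_penalty\<close>). At that multiplier the dual function equals the primal optimum, so the
  dual minimum is attained there and the two values agree. Finally, at any optimal multiplier the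
  maximum of the Lagrangian is the primal optimum, which is already reached by every primal optimal
  solution.\<close>

lemma exact_penalty:
  fixes f g :: "'a \<Rightarrow> real"
  assumes "finite X"
    and nonneg: "\<And>x. x \<in> X \<Longrightarrow> 0 \<le> g x"
    and bound: "\<And>x. x \<in> X \<Longrightarrow> g x = 0 \<Longrightarrow> f x \<le> v"
  obtains l where "0 \<le> l" "\<And>x. x \<in> X \<Longrightarrow> f x - l * g x \<le> v"
proof
  \<comment> \<open>A point with positive penalty needs a multiplier of at least \<open>(f x - v) / g x\<close>; the sum of
    their absolute values is at least each of these ratios. Points with \<open>g x = 0\<close> contribute 0, because
    division by zero yields 0.\<close>
  let ?l = "\<Sum>x\<in>X. \<bar>f x - v\<bar> / g x"
  show "0 \<le> ?l"
    by (intro sum_nonneg divide_nonneg_nonneg) (auto simp: nonneg)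
  fix x assume x: "x \<in> X"
  show "f x - ?l * g x \<le> v"
  proof (cases "g x = 0")
    case True
    then show ?thesis using bound[OF x] by simp
  next
    case False
    then have pos: "0 < g x" using nonneg[OF x] by simp
    have "\<bar>f x - v\<bar> / g x \<le> ?l"
      by (rule member_le_sum[OF x]) (auto simp: nonneg \<open>finite X\<close>)
    then have "\<bar>f x - v\<bar> \<le> ?l * g x"
      using pos by (simp add: pos_divide_le_eq)
    then show ?thesis by linarith
  qed
qed

lemma quad_form_nonneg:
  fixes A :: "real ^ 'n ^ 'n"
  assumes "\<And>i j. 0 \<le> A $ i $ j" and "\<And>i. 0 \<le> x $ i"
  shows "0 \<le> quad_form A x"
  unfolding quad_form_def inner_vec_def matrix_vector_mult_def
  using assms by (auto intro!: sum_nonneg mult_nonneg_nonneg)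

lemma quad_form_le_gqss_value:
  "x \<in> gqss_feasible A \<Longrightarrow> quad_form W x \<le> gqss_value W A"
  unfolding gqss_value_def by (rule Max_ge) (auto simp: finite_gqss_feasible)

lemma gqss_optimal_iff:
  "gqss_optimal W A x \<longleftrightarrow> x \<in> gqss_feasible A \<and> quad_form W x = gqss_value W A"
proof -
  have "gqss_value W A = quad_form W x \<longleftrightarrow> (\<forall>y\<in>gqss_feasible A. quad_form W y \<le> quad_form W x)"
    if "x \<in> gqss_feasible A"
    unfolding gqss_value_def using that by (subst Max_eq_iff) (auto simp: finite_gqss_feasible)
  then show ?thesis
    unfolding gqss_optimal_def is_arg_max_linorder by auto
qed

lemma ex_gqss_optimal: "\<exists>x. gqss_optimal W A x"
proof -
  have "gqss_value W A \<in> quad_form W ` gqss_feasible A"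
    unfolding gqss_value_def using zero_in_gqss_feasible
    by (intro Max_in finite_imageI finite_gqss_feasible) blast
  then show ?thesis unfolding gqss_optimal_iff by force
qed

lemma lagrangian_le_dual_function:
  "x \<in> binary_vectors \<Longrightarrow> lagrangian W A l x \<le> dual_function W A l"
  unfolding dual_function_def by (rule Max_ge) (auto simp: finite_binary_vectors)

lemma lagrangian_maximizerI:
  assumes "x \<in> binary_vectors" and "lagrangian W A l x = dual_function W A l"
  shows "lagrangian_maximizer W A l x"
  unfolding lagrangian_maximizer_def is_arg_max_linorder
  using assms lagrangian_le_dual_function by metis

lemma gqss_optimal_lagrangian:
  assumes "gqss_optimal W A x"
  shows "x \<in> binary_vectors" and "lagrangian W A l x = gqss_value W A"
  using assms by (auto simp: gqss_optimal_iff gqss_feasible_def lagrangian_def)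

text \<open>Weak duality: a primal optimal solution pays no penalty and competes in the Lagrangian
  maximum.\<close>

lemma gqss_value_le_dual_function: "gqss_value W A \<le> dual_function W A l"
  using ex_gqss_optimal gqss_optimal_lagrangian lagrangian_le_dual_function by metis

lemma ex_multiplier_attaining_gqss_value:
  fixes W A :: "real ^ 'n ^ 'n"
  assumes "\<And>i j. 0 \<le> A $ i $ j"
  shows "\<exists>l\<ge>0. dual_function W A l = gqss_value W A"
proof -
  have nonneg: "0 \<le> quad_form A x" if "x \<in> binary_vectors" for x
  proof (rule quad_form_nonneg[OF assms])
    show "0 \<le> x $ i" for i
      using that by (cases "x $ i = 0") (auto simp: binary_vectors_def)
  qed
  have bound: "quad_form W x \<le> gqss_value W A" if "x \<in> binary_vectors" "quad_form A x = 0" for x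
    using that by (intro quad_form_le_gqss_value) (simp add: gqss_feasible_def)
  obtain l where "0 \<le> l"
    and l: "\<And>x. x \<in> binary_vectors \<Longrightarrow> quad_form W x - l * quad_form A x \<le> gqss_value W A"
    using exact_penalty[where f = "quad_form W" and g = "quad_form A",
        OF finite_binary_vectors nonneg bound] by blast
  have "dual_function W A l \<le> gqss_value W A"
    unfolding dual_function_def using zero_in_binary_vectors
    by (subst Max_le_iff) (auto simp: finite_binary_vectors lagrangian_def l)
  with gqss_value_le_dual_function[of W A l] \<open>0 \<le> l\<close> show ?thesis by auto
qed

theorem proposition3:
  fixes W A :: "real ^ 'n ^ 'n"
  assumes "transpose W = W"
    and "transpose A = A"
    and "\<And>i j. 0 \<le> A $ i $ j"
    and "\<And>i j. W $ i $ j * A $ i $ j = 0"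
  shows "(\<exists>l. dual_optimal W A l)
    \<and> gqss_value W A = dual_value W A
    \<and> (\<forall>l. dual_optimal W A l \<longrightarrow>
          (\<exists>x. lagrangian_maximizer W A l x \<and> gqss_optimal W A x))"
proof -
  obtain l0 where l0: "0 \<le> l0" "dual_function W A l0 = gqss_value W A"
    using ex_multiplier_attaining_gqss_value[of A W] assms(3) by blast
  have optimal_iff: "dual_optimal W A l \<longleftrightarrow> 0 \<le> l \<and> dual_function W A l = gqss_value W A" for l
    unfolding dual_optimal_def is_arg_min_linorder
    using l0 gqss_value_le_dual_function[of W A] by (metis order_antisym)
  have "dual_value W A = gqss_value W A"
    unfolding dual_value_def
    by (rule cInf_eq_minimum) (use l0 gqss_value_le_dual_function in force)+
  moreover have "\<exists>x. lagrangian_maximizer W A l x \<and> gqss_optimal W A x"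
    if "dual_optimal W A l" for l
  proof -
    obtain x where x: "gqss_optimal W A x" using ex_gqss_optimal by blast
    have "lagrangian_maximizer W A l x"
      using gqss_optimal_lagrangian[OF x] that
      by (intro lagrangian_maximizerI) (auto simp: optimal_iff)
    with x show ?thesis by blast
  qed
  ultimately show ?thesis using l0 optimal_iff by auto
qed

end
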